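(* Consider $N=2$ non-interacting fermions on the triangle graph ($M=3$), with $$H_0=\begin{pmatrix}4&-1&1\\-1&4&-1\\1&-1&4\end{pmatrix}$$ on $\mathcal{H}_2=\Lambda^2\mathbb{C}^3$ in the orthonormal basis $(e_1\wedge e_2,\,e_1\wedge e_3,\,e_2\wedge e_3)$. Then every density in $\mathcal{P}_{3,2}^+$ is pure-state $v$-representable, $\tilde F=F$ (so $\tilde F$ is convex), and $$\tilde F(\rho)=\begin{cases}3&\rho\in\mathcal{C},\\ 4+2(\alpha_1-\alpha_2-\alpha_3)&\rho\in\mathcal{S}_1,\\ 4+2(-\alpha_1-\alpha_2+\alpha_3)&\rho\in\mathcal{S}_2,\\ 4+2(-\alpha_1+\alpha_2-\alpha_3)&\rho\in\mathcal{S}_3,\end{cases}$$ where $\alpha_1=\sqrt{(1-\rho_1)(1-\rho_3)}$, $\alpha_2=\sqrt{(1-\rho_1)(1-\rho_2)}$, $\alpha_3=\sqrt{(1-\rho_2)(1-\rho_3)}$.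
   Context: $\mathcal{P}_{3,2}=\{\rho\in\mathbb{R}^3\mid0\le\rho_i\le1,\ \rho_1+\rho_2+\rho_3=2\}$, an equilateral triangle with corners $(1,1,0),(1,0,1),(0,1,1)$; $\mathcal{P}_{3,2}^+$ is the subset with $0<\rho_i<1$ for all $i$. $\mathcal{C}$ is the closed incircle region $\mathcal{C}=\{\rho\in\mathcal{P}_{3,2}\mid\|\rho-\tfrac23(1,1,1)\|\le 1/\sqrt6\}$ (Euclidean norm), which touches the boundary of the triangle at $(\tfrac12,1,\tfrac12)$, $(1,\tfrac12,\tfrac12)$, $(\tfrac12,\tfrac12,1)$. $\mathcal{S}_1,\mathcal{S}_2,\mathcal{S}_3$ are the three connected components ("spikes") of $\mathcal{P}_{3,2}^+\setminus\mathcal{C}$ whose closures contain the corners $(1,0,1)$, $(0,1,1)$, $(1,1,0)$, respectively. The density of a normalized $\Psi=\sum_{i<j}\Psi_{(i,j)}e_i\wedge e_j$ is $\rho_k=\sum_{(i,j)\ni k}|\Psi_{(i,j)}|^2$; the density of a density matrix $\Gamma$ (positive semidefinite, trace one on $\mathcal{H}_2$) is $\rho_k=\sum_{(i,j)\ni k}\Gamma_{(i,j),(i,j)}$. A potential $v\in\mathbb{R}^3$ acts as $V(e_i\wedge e_j)=(v_i+v_j)e_i\wedge e_j$. A density $\rho$ is pure-state $v$-representable if there are $v\in\mathbb{R}^3$ and a normalized ground state $\Psi$ of $H_0+V$ with density $\rho$. For $\rho\in\mathcal{P}_{3,2}$: $\tilde F(\rho)=\inf\{\langle\Psi,H_0\Psi\rangle\mid\|\Psi\|=1,\Psi\text{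 has density }\rho\}$ and $F(\rho)=\inf\{\mathrm{Tr}(\Gamma H_0)\mid\Gamma\text{ a density matrix with density }\rho\}$; both are $+\infty$ outside $\mathcal{P}_{3,2}$. *)

theory Defs
  imports "HOL-Analysis.Analysis"
begin

text \<open>
  Two fermions on three sites. A vector of the second exterior power of C^3 is given by its
  coordinates in the orthonormal basis e1 /\ e2, e1 /\ e3, e2 /\ e3, i.e. as an element of
  \<^typ>\<open>complex^3\<close>, where \<open>\<Psi> $ 1\<close>, \<open>\<Psi> $ 2\<close>, \<open>\<Psi> $ 3\<close> are the coefficients of the three basis
  vectors in this order. The set \<open>occ I\<close> contains the two sites occupied in the \<open>I\<close>-th basis vector.
  Note that \<open>3 = 0\<close> in the index type, so its built-in order is not used.
\<close>

definition occ :: "3 \<Rightarrow> 3 set" where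
  "occ I = (if I = 1 then {1, 2} else if I = 2 then {1, 3} else {2, 3})"

definition H0 :: "complex^3^3" where
  "H0 = vector [vector [ 4, -1,  1],
                vector [-1,  4, -1],
                vector [ 1, -1,  4]]"

definition potential :: "real^3 \<Rightarrow> complex^3^3" where
  "potential v = (\<chi> I J. if I = J then complex_of_real (\<Sum>k\<in>occ I. v $ k) else 0)"

text \<open>Physicists' convention: conjugate-linear in the first argument.\<close>

definition cdot :: "complex^'n \<Rightarrow> complex^'n \<Rightarrow> complex" where
  "cdot x y = (\<Sum>i\<in>UNIV. cnj (x $ i) * y $ i)"

definition hermitian :: "complex^'n^'n \<Rightarrow> bool" where
  "hermitian A \<longleftrightarrow> (\<forall>i j. A $ i $ j = cnj (A $ j $ i))"

definition density :: "complex^3 \<Rightarrow> real^3" where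
  "density \<Psi> = (\<chi> k. \<Sum>I | k \<in> occ I. (cmod (\<Psi> $ I))\<^sup>2)"

definition psd :: "complex^'n^'n \<Rightarrow> bool" where
  "psd A \<longleftrightarrow> hermitian A \<and> (\<forall>x. 0 \<le> Re (cdot x (A *v x)))"

definition density_matrix :: "complex^'n^'n \<Rightarrow> bool" where
  "density_matrix \<Gamma> \<longleftrightarrow> psd \<Gamma> \<and> trace \<Gamma> = 1"

definition mdensity :: "complex^3^3 \<Rightarrow> real^3" where
  "mdensity \<Gamma> = (\<chi> k. \<Sum>I | k \<in> occ I. Re (\<Gamma> $ I $ I))"

text \<open>
  Only real eigenvalues are considered; this is no restriction for Hermitian matrices, to which
  the notion is applied below.
\<close>

definition eigval :: "complex^'n^'n \<Rightarrow> real \<Rightarrow> bool" where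
  "eigval H E \<longleftrightarrow> (\<exists>\<Phi>. \<Phi> \<noteq> 0 \<and> H *v \<Phi> = complex_of_real E *s \<Phi>)"

definition ground_state :: "complex^'n^'n \<Rightarrow> complex^'n \<Rightarrow> bool" where
  "ground_state H \<Psi> \<longleftrightarrow> \<Psi> \<noteq> 0 \<and>
     (\<exists>E. H *v \<Psi> = complex_of_real E *s \<Psi> \<and> (\<forall>E'. eigval H E' \<longrightarrow> E \<le> E'))"

definition pure_v_representable :: "real^3 \<Rightarrow> bool" where
  "pure_v_representable \<rho> \<longleftrightarrow>
     (\<exists>v \<Psi>. norm \<Psi> = 1 \<and> ground_state (H0 + potential v) \<Psi> \<and> density \<Psi> = \<rho>)"

definition P32 :: "(real^3) set" where
  "P32 = {\<rho>. (\<forall>i. 0 \<le> \<rho> $ i \<and> \<rho> $ i \<le> 1) \<and> \<rho> $ 1 + \<rho> $ 2 + \<rho> $ 3 = 2}"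

definition P32_plus :: "(real^3) set" where
  "P32_plus = {\<rho> \<in> P32. \<forall>i. 0 < \<rho> $ i \<and> \<rho> $ i < 1}"

definition incircle :: "(real^3) set" where
  "incircle = {\<rho> \<in> P32. norm (\<rho> - (2/3) *\<^sub>R vector [1, 1, 1]) \<le> 1 / sqrt 6}"

definition spike :: "real^3 \<Rightarrow> (real^3) set" where
  "spike corner = (THE S. S \<in> components (P32_plus - incircle) \<and> corner \<in> closure S)"

definition S1 :: "(real^3) set" where "S1 = spike (vector [1, 0, 1])"
definition S2 :: "(real^3) set" where "S2 = spike (vector [0, 1, 1])"
definition S3 :: "(real^3) set" where "S3 = spike (vector [1, 1, 0])"

definition F_pure :: "real^3 \<Rightarrow> ereal" where
  "F_pure \<rho> = (if \<rho> \<in> P32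
     then INF \<Psi> \<in> {\<Psi>. norm \<Psi> = 1 \<and> density \<Psi> = \<rho>}. ereal (Re (cdot \<Psi> (H0 *v \<Psi>)))
     else \<infinity>)"

definition F_mixed :: "real^3 \<Rightarrow> ereal" where
  "F_mixed \<rho> = (if \<rho> \<in> P32
     then INF \<Gamma> \<in> {\<Gamma>. density_matrix \<Gamma> \<and> mdensity \<Gamma> = \<rho>}. ereal (Re (trace (\<Gamma> ** H0)))
     else \<infinity>)"

text \<open>
  Meant for functions that do not take the value \<open>-\<infinity>\<close>, so that no sum \<open>\<infinity> + (-\<infinity>)\<close> occurs.
\<close>

definition ereal_convex :: "('a::real_vector \<Rightarrow> ereal) \<Rightarrow> bool" where
  "ereal_convex f \<longleftrightarrow> (\<forall>x y t. 0 < t \<and> t < 1 \<longrightarrow>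
     f ((1 - t) *\<^sub>R x + t *\<^sub>R y) \<le> ereal (1 - t) * f x + ereal t * f y)"


text \<open>
  The following facts tie the coordinates to the exterior product: \<^term>\<open>H0\<close> is the
  non-interacting Hamiltonian induced by the graph Laplacian of the triangle, and
  \<^term>\<open>potential v\<close> is induced by the one-particle multiplication operator \<open>v\<close>.
\<close>

definition wedge :: "complex^3 \<Rightarrow> complex^3 \<Rightarrow> complex^3" where
  "wedge u w = vector [u $ 1 * w $ 2 - u $ 2 * w $ 1,
                       u $ 1 * w $ 3 - u $ 3 * w $ 1,
                       u $ 2 * w $ 3 - u $ 3 * w $ 2]"

definition laplacian :: "complex^3^3" where
  "laplacian = (\<chi> i j. if i = j then 2 else -1)"

lemma wedge_basis:
  "wedge (axis 1 1) (axis 2 1) = axis 1 1"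
  "wedge (axis 1 1) (axis 3 1) = axis 2 1"
  "wedge (axis 2 1) (axis 3 1) = axis 3 1"
  by (simp_all add: wedge_def vec_eq_iff forall_3 axis_def vector_3)

lemma H0_noninteracting:
  "H0 *v wedge u w = wedge (laplacian *v u) w + wedge u (laplacian *v w)"
  by (simp add: H0_def wedge_def laplacian_def vec_eq_iff forall_3 matrix_vector_mult_def sum_3
      vector_3 algebra_simps)

lemma potential_noninteracting:
  "potential v *v wedge u w =
     wedge (\<chi> k. complex_of_real (v $ k) * u $ k) w + wedge u (\<chi> k. complex_of_real (v $ k) * w $ k)"
  by (simp add: potential_def occ_def wedge_def vec_eq_iff forall_3 matrix_vector_mult_def sum_3
      vector_3 algebra_simps)

end

theory Submission
  imports Defs
begin

text \<open>
  With \<open>w = (1, -1, 1)\<close> one has \<open>H0 = 3 + |w><w|\<close>, and a density fixes the moduli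
  \<open>p = sqrt (1 - \<rho>3)\<close>, \<open>q = sqrt (1 - \<rho>2)\<close>, \<open>r = sqrt (1 - \<rho>1)\<close> of the three coefficients.
  So the pure-state problem is to minimise the modulus of a sum of three complex numbers of
  moduli \<open>p\<close>, \<open>q\<close>, \<open>r\<close>: the minimum is \<open>0\<close> if they satisfy the triangle inequalities and
  \<open>p - q - r\<close> (up to permutation) otherwise. By Heron's formula the triangle inequalities cut out
  the incircle. A density matrix cannot do better, because \<open>x \<mapsto> sqrt <x, \<Gamma> x>\<close> is a seminorm taking the
  values \<open>p\<close>, \<open>q\<close>, \<open>r\<close> at the basis vectors. Hence the two functionals agree, and the mixed one is
  convex. For a density in a spike the minimiser is real, and its eigenvalue equation at energy 3
  determines a potential; that 3 is the lowest eigenvalue is then a positivity statement about a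
  diagonal plus rank-one form.
\<close>

section \<open>Sums of three complex numbers with prescribed moduli\<close>

text \<open>For nonnegative arguments at most one of the three differences is positive, so the
  maximum records which modulus dominates, if any.\<close>

definition defect :: "real \<Rightarrow> real \<Rightarrow> real \<Rightarrow> real" where
  "defect p q r = max 0 (max (p - q - r) (max (q - p - r) (r - p - q)))"

lemma defect_nonneg: "0 \<le> defect p q r"
  by (simp add: defect_def)

lemma defect_eq_0_iff: "defect p q r = 0 \<longleftrightarrow> p \<le> q + r \<and> q \<le> p + r \<and> r \<le> p + q"
  unfolding defect_def by linarith

lemma defect_eq_diff:
  assumes "0 \<le> q" "0 \<le> r" "q + r < p"
  shows "defect p q r = p - q - r" "defect q p r = p - q - r" "defect q r p = p - q - r"
  using assms by (simp_all add: defect_def)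

text \<open>The summands are the sides of a triangle traversed as vectors in the plane; degenerate
  triangles are included.\<close>

lemma triangle_closes:
  fixes p q r :: real
  assumes "0 \<le> p" "0 \<le> q" "0 \<le> r" "p \<le> q + r" "q \<le> p + r" "r \<le> p + q"
  obtains a b c where "cmod a = p" "cmod b = q" "cmod c = r" "a + b + c = 0"
proof (cases "p = 0")
  case True
  then have "r = q" using assms by simp
  then show ?thesis
    using that[of 0 "complex_of_real q" "- complex_of_real q"] True assms by simp
next
  case False
  \<comment> \<open>With \<open>a = p\<close> on the real axis and \<open>b = Complex X Y\<close>,
    the conditions \<open>cmod b = q\<close> and \<open>cmod (a + b) = r\<close> force this
    \<open>X\<close> (law of cosines).\<close>
  define X where "X = (r\<^sup>2 - p\<^sup>2 - q\<^sup>2) / (2 * p)"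
  define Y where "Y = sqrt (q\<^sup>2 - X\<^sup>2)"
  have pX: "2 * p * X = r\<^sup>2 - p\<^sup>2 - q\<^sup>2"
    using False by (simp add: X_def)
  \<comment> \<open>These bounds amount to \<open>- q \<le> X\<close> and \<open>X \<le> q\<close>,
    which make the radicand of \<open>Y\<close> nonnegative.\<close>
  have "r\<^sup>2 \<le> (p + q)\<^sup>2" "(p - q)\<^sup>2 \<le> r\<^sup>2"
    using assms by (simp_all flip: abs_le_square_iff)
  then have "p * X \<le> p * q" "p * (- q) \<le> p * X"
    using pX by (simp_all add: power2_sum power2_diff)
  then have "X \<le> q" "- q \<le> X"
    using False assms(1) by (auto simp only: mult_le_cancel_left)
  then have "X\<^sup>2 \<le> q\<^sup>2"
    by (simp add: abs_le_square_iff[symmetric])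
  then have Y: "X\<^sup>2 + Y\<^sup>2 = q\<^sup>2"
    by (simp add: Y_def)
  have "(p + X)\<^sup>2 + Y\<^sup>2 = r\<^sup>2"
    using Y pX by (simp add: power2_eq_square algebra_simps)
  then show ?thesis
    using Y assms
    by (intro that[of "complex_of_real p" "Complex X Y" "- Complex (p + X) Y"])
      (simp_all add: complex_eq_iff, simp_all add: cmod_def)
qed

lemma defect_attained:
  assumes "0 \<le> p" "0 \<le> q" "0 \<le> r"
  obtains a b c where "cmod a = p" "cmod b = q" "cmod c = r" "cmod (a + b + c) = defect p q r"
proof -
  consider "q + r < p" | "p + r < q" | "p + q < r" | "p \<le> q + r" "q \<le> p + r" "r \<le> p + q"
    by linarith
  then show ?thesis
  proof cases
    case 1
    have "complex_of_real p + - complex_of_real q + - complex_of_real r = complex_of_real (p - q - r)" by simp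
    then show ?thesis using 1 assms
      by (intro that[of "of_real p" "- of_real q" "- of_real r"])
        (simp_all only: norm_of_real norm_minus_cancel, simp_all add: defect_def)
  next
    case 2
    have "- complex_of_real p + complex_of_real q + - complex_of_real r = complex_of_real (q - p - r)" by simp
    then show ?thesis using 2 assms
      by (intro that[of "- of_real p" "of_real q" "- of_real r"])
        (simp_all only: norm_of_real norm_minus_cancel, simp_all add: defect_def)
  next
    case 3
    have "- complex_of_real p + - complex_of_real q + complex_of_real r = complex_of_real (r - p - q)" by simp
    then show ?thesis using 3 assms
      by (intro that[of "- of_real p" "- of_real q" "of_real r"])
        (simp_all only: norm_of_real norm_minus_cancel, simp_all add: defect_def)
  next
    case 4
    with triangle_closes[OF assms] obtain a b c
      where "cmod a = p" "cmod b = q" "cmod c = r" "a + b + c = 0" by metis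
    with 4 that[of a b c] show ?thesis by (simp add: defect_def)
  qed
qed

text \<open>The difference of the two sides is sixteen times Heron's squared area. If a triangle
  inequality fails, exactly one factor of \<open>P\<close> is negative and the perimeter is
  positive.\<close>

lemma heron_nonneg_iff:
  fixes p q r :: real
  assumes "0 \<le> p" "0 \<le> q" "0 \<le> r"
  shows "2 * (p ^ 4 + q ^ 4 + r ^ 4) \<le> (p\<^sup>2 + q\<^sup>2 + r\<^sup>2)\<^sup>2 \<longleftrightarrow> defect p q r = 0"
proof -
  define P where "P = (q + r - p) * (p + r - q) * (p + q - r)"
  have "(p\<^sup>2 + q\<^sup>2 + r\<^sup>2)\<^sup>2 - 2 * (p ^ 4 + q ^ 4 + r ^ 4) = (p + q + r) * P"
    unfolding P_def by algebra
  moreover consider "q + r < p" | "p + r < q" | "p + q < r"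
    | "p \<le> q + r" "q \<le> p + r" "r \<le> p + q"
    by linarith
  then have "(0 \<le> (p + q + r) * P) = (defect p q r = 0)"
  proof cases
    case 4
    then show ?thesis using assms by (simp add: P_def defect_def)
  qed (use assms in \<open>auto simp: P_def defect_def zero_le_mult_iff mult_le_0_iff\<close>)
  ultimately show ?thesis by linarith
qed


section \<open>Coordinates\<close>

lemma sum_occ:
  "(\<Sum>I | (1::3) \<in> occ I. f I) = f 1 + f 2"
  "(\<Sum>I | (2::3) \<in> occ I. f I) = f 1 + f 3"
  "(\<Sum>I | (3::3) \<in> occ I. f I) = f 2 + (f 3 :: real)"
proof -
  have "(\<Sum>I | k \<in> occ I. f I) = (\<Sum>I\<in>UNIV. if k \<in> occ I then f I else 0)" for k
    by (simp add: sum.inter_filter[symmetric])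
  then show
    "(\<Sum>I | (1::3) \<in> occ I. f I) = f 1 + f 2"
    "(\<Sum>I | (2::3) \<in> occ I. f I) = f 1 + f 3"
    "(\<Sum>I | (3::3) \<in> occ I. f I) = f 2 + f 3"
    by (simp_all add: sum_3 occ_def)
qed

lemma norm_vec3_power2: "(norm (\<Psi> :: complex^3))\<^sup>2 = (cmod (\<Psi> $ 1))\<^sup>2 + (cmod (\<Psi> $ 2))\<^sup>2 + (cmod (\<Psi> $ 3))\<^sup>2"
  by (simp add: norm_vec_def L2_set_def sum_3)

text \<open>Site \<open>k\<close> is empty in exactly one basis vector, so normalization turns
  \<open>\<rho> $ k\<close> into one minus a single squared modulus. The phases stay free.\<close>

lemma norm_density_iff:
  assumes "\<rho> $ 1 + \<rho> $ 2 + \<rho> $ 3 = 2"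
  shows "norm \<Psi> = 1 \<and> density \<Psi> = \<rho> \<longleftrightarrow>
    (cmod (\<Psi> $ 1))\<^sup>2 = 1 - \<rho> $ 3 \<and> (cmod (\<Psi> $ 2))\<^sup>2 = 1 - \<rho> $ 2 \<and> (cmod (\<Psi> $ 3))\<^sup>2 = 1 - \<rho> $ 1"
proof -
  have "norm \<Psi> = 1 \<longleftrightarrow> (norm \<Psi>)\<^sup>2 = 1"
    by (simp add: power2_eq_1_iff)
      (metis norm_ge_zero not_one_le_zero neg_0_le_iff_le)
  then show ?thesis
    using assms by (auto simp: norm_vec3_power2 density_def vec_eq_iff forall_3 sum_occ)
qed

lemma energy_eq:
  "Re (cdot \<Psi> ((H0 + potential v) *v \<Psi>)) =
     3 * (norm \<Psi>)\<^sup>2 + (cmod (\<Psi> $ 1 - \<Psi> $ 2 + \<Psi> $ 3))\<^sup>2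
     + (v $ 1 + v $ 2) * (cmod (\<Psi> $ 1))\<^sup>2 + (v $ 1 + v $ 3) * (cmod (\<Psi> $ 2))\<^sup>2
     + (v $ 2 + v $ 3) * (cmod (\<Psi> $ 3))\<^sup>2"
  unfolding norm_vec3_power2 cmod_power2
  by (simp add: cdot_def matrix_vector_mult_def sum_3 H0_def vector_3
      potential_def occ_def algebra_simps power2_eq_square)

lemma potential_0 [simp]: "potential 0 = 0"
  by (simp add: potential_def vec_eq_iff)

lemma energy_H0_eq:
  "Re (cdot \<Psi> (H0 *v \<Psi>)) = 3 * (norm \<Psi>)\<^sup>2 + (cmod (\<Psi> $ 1 - \<Psi> $ 2 + \<Psi> $ 3))\<^sup>2"
  using energy_eq[of \<Psi> 0] by simp


section \<open>The value of both functionals\<close>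

definition F_value :: "real^3 \<Rightarrow> real" where
  "F_value \<rho> = 3 + (defect (sqrt (1 - \<rho> $ 3)) (sqrt (1 - \<rho> $ 2)) (sqrt (1 - \<rho> $ 1)))\<^sup>2"

lemma F_value_attained:
  assumes "\<rho> \<in> P32"
  obtains \<Psi> where "norm \<Psi> = 1" "density \<Psi> = \<rho>" "Re (cdot \<Psi> (H0 *v \<Psi>)) = F_value \<rho>"
proof -
  have \<rho>: "0 \<le> 1 - \<rho> $ 3" "0 \<le> 1 - \<rho> $ 2" "0 \<le> 1 - \<rho> $ 1" "\<rho> $ 1 + \<rho> $ 2 + \<rho> $ 3 = 2"
    using assms by (auto simp: P32_def)
  obtain a b c where abc: "cmod a = sqrt (1 - \<rho> $ 3)" "cmod b = sqrt (1 - \<rho> $ 2)"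
    "cmod c = sqrt (1 - \<rho> $ 1)"
    "cmod (a + b + c) = defect (sqrt (1 - \<rho> $ 3)) (sqrt (1 - \<rho> $ 2)) (sqrt (1 - \<rho> $ 1))"
    using defect_attained \<rho> by (metis real_sqrt_ge_zero)
  \<comment> \<open>The sign cancels the one in \<open>\<Psi> $ 1 - \<Psi> $ 2 + \<Psi> $ 3\<close>,
    which becomes \<open>a + b + c\<close>.\<close>
  define \<Psi> :: "complex^3" where "\<Psi> = vector [a, - b, c]"
  have "norm \<Psi> = 1 \<and> density \<Psi> = \<rho>"
    unfolding norm_density_iff[OF \<rho>(4)] using \<rho> by (simp add: \<Psi>_def vector_3 abc)
  moreover have "Re (cdot \<Psi> (H0 *v \<Psi>)) = F_value \<rho>"
    using calculation abc(4) by (simp add: energy_H0_eq F_value_def \<Psi>_def vector_3)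
  ultimately show ?thesis using that by blast
qed

section \<open>Positive semidefinite forms and the lower bound on the energy\<close>

lemma cdot_add_left: "cdot (x + y) z = cdot x z + cdot y z"
  by (simp add: cdot_def algebra_simps sum.distrib)

lemma cdot_add_right: "cdot x (y + z) = cdot x y + cdot x z"
  by (simp add: cdot_def algebra_simps sum.distrib)

lemma cdot_scaleC_left: "cdot (s *s x) y = cnj s * cdot x y"
  by (simp add: cdot_def sum_distrib_left mult_ac)

lemma cdot_scaleC_right: "cdot x (s *s y) = s * cdot x y"
  by (simp add: cdot_def sum_distrib_left mult_ac)

lemma cdot_scaleR_right: "cdot x (s *\<^sub>R y) = s *\<^sub>R cdot x y"
  by (simp add: cdot_def scaleR_sum_right)

lemma cdot_commute: "cdot y x = cnj (cdot x y)"
  by (simp add: cdot_def mult_ac)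

lemma cnj_hermitian: "hermitian A \<Longrightarrow> cnj (A $ i $ j) = A $ j $ i"
  unfolding hermitian_def by metis

lemma hermitian_cdot:
  assumes "hermitian A"
  shows "cdot (A *v x) y = cdot x (A *v y)"
proof -
  have "cdot (A *v x) y = (\<Sum>i\<in>UNIV. \<Sum>j\<in>UNIV. cnj (x $ j) * cnj (A $ i $ j) * y $ i)"
    by (simp add: cdot_def matrix_vector_mult_def sum_distrib_right sum_distrib_left mult_ac)
  also have "\<dots> = (\<Sum>j\<in>UNIV. \<Sum>i\<in>UNIV. cnj (x $ j) * cnj (A $ i $ j) * y $ i)"
    by (rule sum.swap)
  also have "\<dots> = cdot x (A *v y)"
    by (simp add: cdot_def matrix_vector_mult_def sum_distrib_right sum_distrib_left mult_ac
        cnj_hermitian[OF assms])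
  finally show ?thesis .
qed

text \<open>It follows from Cauchy-Schwarz for the real part \<open>B\<close> of the cross term.
  Real multiples \<open>t\<close> suffice: along \<open>x + t y\<close> the form is a nonnegative
  quadratic in \<open>t\<close>.\<close>

lemma psd_seminorm_triangle:
  assumes "psd A"
  shows "sqrt (Re (cdot (x + y) (A *v (x + y)))) \<le>
    sqrt (Re (cdot x (A *v x))) + sqrt (Re (cdot y (A *v y)))"
proof -
  define Qx Qy B where "Qx = Re (cdot x (A *v x))" and "Qy = Re (cdot y (A *v y))"
    and "B = Re (cdot x (A *v y))"
  have herm: "hermitian A" and pos: "0 \<le> Re (cdot z (A *v z))" for z
    using assms by (auto simp: psd_def)
  have B': "Re (cdot y (A *v x)) = B"
    unfolding B_def hermitian_cdot[OF herm, of y x, symmetric] cdot_commute[of "A *v y" x]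
    by simp
  have expand: "Re (cdot (x + of_real t *s y) (A *v (x + of_real t *s y))) = Qx + 2 * t * B + t\<^sup>2 * Qy" for t
    by (simp add: matrix_vector_right_distrib vector_scalar_commute cdot_add_left cdot_add_right
        cdot_scaleC_left cdot_scaleC_right B' Qx_def Qy_def algebra_simps power2_eq_square
        flip: B_def)
  have Q: "0 \<le> Qx" "0 \<le> Qy" "0 \<le> Qx + 2 * t * B + t\<^sup>2 * Qy" for t
    using pos[of x] pos[of y] pos[of "x + of_real t *s y"] by (simp_all only: expand Qx_def Qy_def)
  have "B \<le> sqrt Qx * sqrt Qy"
  proof (cases "Qy = 0")
    case True
    have "B \<le> 0"
    proof (rule ccontr)
      assume "\<not> B \<le> 0"
      \<comment> \<open>For \<open>Qy = 0\<close> the quadratic is affine in \<open>t\<close>; at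
        this \<open>t\<close> it would equal \<open>-1\<close>.\<close>
      then show False using Q(3)[of "- (Qx + 1) / (2 * B)"] True by (simp add: field_simps)
    qed
    then show ?thesis using True by simp
  next
    case False
    have "B\<^sup>2 \<le> Qx * Qy"
      using Q(3)[of "- B / Qy"] False Q(2)
      by (simp add: power2_eq_square field_simps)
    then have "\<bar>B\<bar> \<le> sqrt (Qx * Qy)"
      by (metis real_sqrt_abs real_sqrt_le_iff)
    then show ?thesis by (simp add: real_sqrt_mult)
  qed
  then have "Qx + 2 * B + Qy \<le> (sqrt Qx + sqrt Qy)\<^sup>2"
    using Q by (simp add: power2_sum)
  then show ?thesis
    using expand[of 1] Q(1,2) by (simp add: real_le_lsqrt flip: Qx_def Qy_def)
qed

text \<open>One bound serves both functionals, since a pure state enters it through its projector;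
  it also drives the convexity proof.\<close>

lemma mixed_energy_lower_bound:
  assumes "density_matrix \<Gamma>"
  shows "F_value (mdensity \<Gamma>) \<le> Re (trace (\<Gamma> ** H0))"
proof -
  define Q where "Q x = Re (cdot x (\<Gamma> *v x))" for x
  have psd: "psd \<Gamma>" and tr: "trace \<Gamma> = 1"
    using assms by (auto simp: density_matrix_def)
  have tri: "sqrt (Q (x + y)) \<le> sqrt (Q x) + sqrt (Q y)" for x y
    using psd_seminorm_triangle[OF psd] by (simp add: Q_def)
  have Q_minus: "Q (- x) = Q x" for x
    by (simp add: Q_def cdot_def matrix_vector_mult_def sum_negf)
  define e1 e2 e3 w :: "complex^3" where "e1 = axis 1 1" and "e2 = axis 2 1" and "e3 = axis 3 1"
    and "w = vector [1, -1, 1]"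
  \<comment> \<open>Solving for each basis vector in turn gives three triangle inequalities, each
    bounding \<open>sqrt (Q w)\<close> from below; the signs do not matter because \<open>Q\<close>
    is even.\<close>
  have w: "w = e1 + - e2 + e3" "e1 = w + e2 + - e3" "- e2 = w + - e1 + - e3" "e3 = w + - e1 + e2"
    by (simp_all add: w_def e1_def e2_def e3_def vec_eq_iff forall_3 vector_3 axis_def)
  \<comment> \<open>\<open>\<Gamma>\<^sub>1\<^sub>1 = 1 - \<rho>3\<close> because site 3 is the one unoccupied in \<open>e1 \<and> e2\<close>, and so on.\<close>
  have Qe: "Q e1 = 1 - mdensity \<Gamma> $ 3" "Q e2 = 1 - mdensity \<Gamma> $ 2" "Q e3 = 1 - mdensity \<Gamma> $ 1"
    using arg_cong[OF tr, of Re]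
    by (simp_all add: Q_def e1_def e2_def e3_def cdot_def matrix_vector_mult_def sum_3 axis_def
        mdensity_def sum_occ trace_def)
  have "sqrt (Q e1) \<le> sqrt (Q w) + sqrt (Q e2) + sqrt (Q e3)"
    "sqrt (Q e2) \<le> sqrt (Q w) + sqrt (Q e1) + sqrt (Q e3)"
    "sqrt (Q e3) \<le> sqrt (Q w) + sqrt (Q e1) + sqrt (Q e2)"
    using tri[of "w + e2" "- e3", folded w(2)] tri[of w e2]
      tri[of "w + - e1" "- e3", folded w(3)] tri[of w "- e1"]
      tri[of "w + - e1" e2, folded w(4)]
    by (simp_all only: Q_minus)
  moreover have Qw: "0 \<le> Q w"
    using psd by (simp add: psd_def Q_def)
  ultimately have "defect (sqrt (Q e1)) (sqrt (Q e2)) (sqrt (Q e3)) \<le> sqrt (Q w)"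
    by (simp add: defect_def)
  then have "(defect (sqrt (Q e1)) (sqrt (Q e2)) (sqrt (Q e3)))\<^sup>2 \<le> Q w"
    using Qw power_mono[OF _ defect_nonneg, of _ _ _ "sqrt (Q w)" 2] by simp
  \<comment> \<open>\<open>H0\<close> minus three times the identity is the rank-one matrix of
    \<open>w\<close>, whose trace against \<open>\<Gamma>\<close> is \<open>Q w\<close>.\<close>
  moreover have "Re (trace (\<Gamma> ** H0)) = 3 * Re (trace \<Gamma>) + Q w"
    by (simp add: Q_def w_def cdot_def matrix_vector_mult_def sum_3 vector_3 trace_def
        matrix_matrix_mult_def H0_def)
  ultimately show ?thesis
    by (simp add: F_value_def Qe tr)
qed

section \<open>Pure states as rank-one density matrices\<close>

definition projector :: "complex^'n \<Rightarrow> complex^'n^'n" where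
  "projector \<Psi> = (\<chi> i j. \<Psi> $ i * cnj (\<Psi> $ j))"

lemma psd_projector: "psd (projector \<Psi>)"
proof -
  have "cdot x (projector \<Psi> *v x) = cdot x \<Psi> * cnj (cdot x \<Psi>)" for x
    unfolding cdot_def projector_def matrix_vector_mult_def cnj_sum sum_product
    by (simp add: sum_distrib_left mult_ac)
  then have "Re (cdot x (projector \<Psi> *v x)) = (cmod (cdot x \<Psi>))\<^sup>2" for x
    by (simp add: complex_norm_square[symmetric] del: complex_norm_square)
  then show ?thesis
    by (simp add: psd_def hermitian_def projector_def)
qed

lemma mdensity_projector: "mdensity (projector \<Psi>) = density \<Psi>"
  unfolding mdensity_def density_def projector_def cmod_power2 by (simp add: power2_eq_square)

lemma density_matrix_projector:
  assumes "norm \<Psi> = 1"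
  shows "density_matrix (projector (\<Psi> :: complex^3))"
proof -
  have "trace (projector \<Psi>) = complex_of_real ((norm \<Psi>)\<^sup>2)"
    unfolding norm_vec3_power2 by (simp add: trace_def projector_def sum_3 flip: complex_norm_square)
  then show ?thesis
    using assms by (simp add: density_matrix_def psd_projector)
qed

lemma trace_projector_H0: "Re (trace (projector \<Psi> ** H0)) = Re (cdot \<Psi> (H0 *v \<Psi>))"
  by (simp add: trace_def cdot_def projector_def matrix_matrix_mult_def matrix_vector_mult_def sum_3
      algebra_simps)

lemma F_pure_eq: "F_pure \<rho> = (if \<rho> \<in> P32 then ereal (F_value \<rho>) else \<infinity>)"
proof (cases "\<rho> \<in> P32")
  case True
  obtain \<Psi> where \<Psi>: "norm \<Psi> = 1" "density \<Psi> = \<rho>" "Re (cdot \<Psi> (H0 *v \<Psi>)) = F_value \<rho>"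
    using F_value_attained[OF True] .
  have "F_value \<rho> \<le> Re (cdot \<Phi> (H0 *v \<Phi>))" if "norm \<Phi> = 1" "density \<Phi> = \<rho>" for \<Phi>
    using mixed_energy_lower_bound[OF density_matrix_projector[OF that(1)]] that(2)
    by (simp add: mdensity_projector trace_projector_H0)
  then have "F_pure \<rho> = ereal (F_value \<rho>)"
    unfolding F_pure_def using True \<Psi>
    by (auto intro!: antisym INF_greatest INF_lower2[of \<Psi>])
  then show ?thesis using True by simp
qed (simp add: F_pure_def)

lemma F_mixed_eq: "F_mixed \<rho> = (if \<rho> \<in> P32 then ereal (F_value \<rho>) else \<infinity>)"
proof (cases "\<rho> \<in> P32")
  case True
  obtain \<Psi> where \<Psi>: "norm \<Psi> = 1" "density \<Psi> = \<rho>" "Re (cdot \<Psi> (H0 *v \<Psi>)) = F_value \<rho>"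
    using F_value_attained[OF True] .
  have "F_value \<rho> \<le> Re (trace (\<Gamma> ** H0))" if "density_matrix \<Gamma>" "mdensity \<Gamma> = \<rho>" for \<Gamma>
    using mixed_energy_lower_bound that by blast
  then have "F_mixed \<rho> = ereal (F_value \<rho>)"
    unfolding F_mixed_def using True \<Psi>
    by (auto intro!: antisym INF_greatest INF_lower2[of "projector \<Psi>"]
        simp: density_matrix_projector mdensity_projector trace_projector_H0)
  then show ?thesis using True by simp
qed (simp add: F_mixed_def)

section \<open>Convexity of the functional\<close>

lemma scaleR_matrix_vector_mult:
  fixes A :: "'a::real_algebra_1^'n^'m"
  shows "(s *\<^sub>R A) *v x = s *\<^sub>R (A *v x)"
  by (simp add: matrix_vector_mult_def vec_eq_iff scaleR_sum_right)

lemma psd_convex_combination: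
  assumes "psd A" "psd B" "0 \<le> s" "0 \<le> t"
  shows "psd (s *\<^sub>R A + t *\<^sub>R B)"
proof -
  have "Re (cdot x ((s *\<^sub>R A + t *\<^sub>R B) *v x)) = s * Re (cdot x (A *v x)) + t * Re (cdot x (B *v x))" for x
    by (simp add: matrix_vector_mult_add_rdistrib cdot_add_right cdot_scaleR_right
        scaleR_matrix_vector_mult)
  moreover have "hermitian (s *\<^sub>R A + t *\<^sub>R B)"
    using assms(1,2) cnj_hermitian[of A] cnj_hermitian[of B]
    by (simp add: psd_def hermitian_def[of "_ + _"])
  ultimately show ?thesis
    using assms unfolding psd_def by simp
qed

text \<open>Mixing the projectors of two pure minimisers gives a density matrix whose density and
  energy are the weighted averages; the lower bound for density matrices then applies to it.\<close>

lemma F_value_convex: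
  assumes "x \<in> P32" "y \<in> P32" "0 < t" "t < 1"
  shows "F_value ((1 - t) *\<^sub>R x + t *\<^sub>R y) \<le> (1 - t) * F_value x + t * F_value y"
proof -
  obtain \<Psi> where \<Psi>: "norm \<Psi> = 1" "density \<Psi> = x" "Re (cdot \<Psi> (H0 *v \<Psi>)) = F_value x"
    using F_value_attained[OF assms(1)] .
  obtain \<Phi> where \<Phi>: "norm \<Phi> = 1" "density \<Phi> = y" "Re (cdot \<Phi> (H0 *v \<Phi>)) = F_value y"
    using F_value_attained[OF assms(2)] .
  define \<Gamma> where "\<Gamma> = (1 - t) *\<^sub>R projector \<Psi> + t *\<^sub>R projector \<Phi>"
  have "trace \<Gamma> = (1 - t) *\<^sub>R trace (projector \<Psi>) + t *\<^sub>R trace (projector \<Phi>)"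
    by (simp add: \<Gamma>_def trace_def sum_3 algebra_simps)
  then have "density_matrix \<Gamma>"
    using density_matrix_projector[OF \<Psi>(1)] density_matrix_projector[OF \<Phi>(1)] assms(3,4)
    unfolding density_matrix_def by (auto simp: \<Gamma>_def psd_convex_combination scaleR_conv_of_real[of _ "1::complex"])
  moreover have "mdensity \<Gamma> = (1 - t) *\<^sub>R x + t *\<^sub>R y"
    unfolding \<Psi>(2)[symmetric] \<Phi>(2)[symmetric] mdensity_projector[symmetric] \<Gamma>_def
    by (simp add: mdensity_def vec_eq_iff forall_3 sum_occ algebra_simps)
  moreover have "Re (trace (\<Gamma> ** H0)) =
      (1 - t) * Re (trace (projector \<Psi> ** H0)) + t * Re (trace (projector \<Phi> ** H0))"
    by (simp add: \<Gamma>_def trace_def matrix_matrix_mult_def sum_3 algebra_simps)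
  ultimately show ?thesis
    using mixed_energy_lower_bound[of \<Gamma>] \<Psi>(3) \<Phi>(3) by (simp add: trace_projector_H0)
qed

lemma P32_convex: "convex P32"
proof (rule convexI)
  fix x y :: "real^3" and u v :: real
  assume xy: "x \<in> P32" "y \<in> P32" and uv: "0 \<le> u" "0 \<le> v" "u + v = 1"
  have "u * x $ i + v * y $ i \<le> 1" for i
    using xy uv by (intro convex_bound_le) (auto simp: P32_def)
  moreover have "u * (x $ 1 + x $ 2 + x $ 3) + v * (y $ 1 + y $ 2 + y $ 3) = 2"
    using xy uv by (simp add: P32_def flip: distrib_right)
  ultimately show "u *\<^sub>R x + v *\<^sub>R y \<in> P32"
    using xy uv by (simp add: P32_def algebra_simps)
qed

lemma F_pure_convex: "ereal_convex F_pure"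
  unfolding ereal_convex_def
proof (intro allI impI)
  fix x y :: "real^3" and t :: real
  assume t: "0 < t \<and> t < 1"
  show "F_pure ((1 - t) *\<^sub>R x + t *\<^sub>R y) \<le> ereal (1 - t) * F_pure x + ereal t * F_pure y"
  proof (cases "x \<in> P32 \<and> y \<in> P32")
    case True
    then have "(1 - t) *\<^sub>R x + t *\<^sub>R y \<in> P32"
      using P32_convex t by (simp add: convex_alt)
    then show ?thesis
      using True t F_value_convex by (simp add: F_pure_eq)
  next
    case False
    \<comment> \<open>Both weights are positive and no value is minus infinity, so the right-hand
      side is infinite.\<close>
    then show ?thesis
      using t by (auto simp: F_pure_eq)
  qed
qed


section \<open>The incircle and the spikes\<close>

text \<open>On the plane of coordinate sum 2, the squared distance from the centre is
  \<open>p ^ 4 + q ^ 4 + r ^ 4 - 1 / 3\<close> in terms of the moduli, so the radius condition reads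
  \<open>2 * (p ^ 4 + q ^ 4 + r ^ 4) \<le> 1\<close>. As the squared moduli sum to 1, this is
  Heron's condition.\<close>

lemma incircle_iff:
  assumes "\<rho> \<in> P32"
  shows "\<rho> \<in> incircle \<longleftrightarrow>
    defect (sqrt (1 - \<rho> $ 3)) (sqrt (1 - \<rho> $ 2)) (sqrt (1 - \<rho> $ 1)) = 0"
proof -
  have \<rho>: "0 \<le> 1 - \<rho> $ 3" "0 \<le> 1 - \<rho> $ 2" "0 \<le> 1 - \<rho> $ 1" and sum: "\<rho> $ 1 + \<rho> $ 2 + \<rho> $ 3 = 2"
    using assms by (auto simp: P32_def)
  have sqrt4: "sqrt x ^ 4 = x\<^sup>2" if "0 \<le> x" for x
    using that power_mult[of "sqrt x" 2 2] by simp
  have "norm (\<rho> - (2/3) *\<^sub>R vector [1, 1, 1]) \<le> 1 / sqrt 6 \<longleftrightarrow>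
      sqrt ((\<rho> $ 1 - 2/3)\<^sup>2 + (\<rho> $ 2 - 2/3)\<^sup>2 + (\<rho> $ 3 - 2/3)\<^sup>2) \<le> sqrt (1 / 6)"
    by (simp add: norm_vec_def L2_set_def sum_3 vector_3 real_sqrt_divide)
  also have "\<dots> \<longleftrightarrow> (\<rho> $ 1 - 2/3)\<^sup>2 + (\<rho> $ 2 - 2/3)\<^sup>2 + (\<rho> $ 3 - 2/3)\<^sup>2 \<le> 1 / 6"
    by simp
  also have "\<dots> \<longleftrightarrow> 2 * ((1 - \<rho> $ 3)\<^sup>2 + (1 - \<rho> $ 2)\<^sup>2 + (1 - \<rho> $ 1)\<^sup>2) \<le> 1"
  proof -
    have 1: "\<rho> $ 1 = 2 - \<rho> $ 2 - \<rho> $ 3" using sum by simp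
    have "(\<rho> $ 1 - 2/3)\<^sup>2 + (\<rho> $ 2 - 2/3)\<^sup>2 + (\<rho> $ 3 - 2/3)\<^sup>2 =
        (1 - \<rho> $ 3)\<^sup>2 + (1 - \<rho> $ 2)\<^sup>2 + (1 - \<rho> $ 1)\<^sup>2 - 1 / 3"
      unfolding 1 by (simp add: power2_eq_square algebra_simps)
    moreover have "A \<le> 1 / 6 \<longleftrightarrow> 2 * T \<le> 1" if "A = T - 1 / 3" for A T :: real
      using that by auto
    ultimately show ?thesis by blast
  qed
  also have "\<dots> \<longleftrightarrow> defect (sqrt (1 - \<rho> $ 3)) (sqrt (1 - \<rho> $ 2)) (sqrt (1 - \<rho> $ 1)) = 0"
  proof -
    have "(sqrt (1 - \<rho> $ 3))\<^sup>2 + (sqrt (1 - \<rho> $ 2))\<^sup>2 + (sqrt (1 - \<rho> $ 1))\<^sup>2 = 1"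
      using sum \<rho> by simp
    then show ?thesis
      using heron_nonneg_iff[OF real_sqrt_ge_zero[OF \<rho>(1)] real_sqrt_ge_zero[OF \<rho>(2)]
          real_sqrt_ge_zero[OF \<rho>(3)]]
      unfolding sqrt4[OF \<rho>(1)] sqrt4[OF \<rho>(2)] sqrt4[OF \<rho>(3)] by simp
  qed
  finally show ?thesis
    using assms by (simp add: incircle_def)
qed


section \<open>Explicit description of the spikes\<close>

text \<open>The threshold is an open condition that at most one coordinate of a point of
  \<open>P32\<close> can meet, so it separates the spikes topologically.\<close>

definition spike_region :: "3 \<Rightarrow> (real^3) set" where
  "spike_region k = {\<rho> \<in> P32_plus - incircle. \<rho> $ k < 1 / 2}"

text \<open>Passes from a dominating modulus to a dominating squared modulus. When the squares sum
  to 1, the dominating one exceeds 1/2, which matches the threshold in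
  \<open>spike_region\<close>.\<close>

lemma sqrt_add_less_imp:
  assumes "0 \<le> b" "0 \<le> c" "sqrt b + sqrt c < sqrt a"
  shows "b + c < a"
proof -
  have "sqrt (b + c) \<le> sqrt b + sqrt c"
    using assms(1,2) by (rule sqrt_add_le_add_sqrt)
  then show ?thesis using assms(3) by (metis le_less_trans real_sqrt_less_iff)
qed

lemma third_index:
  fixes k l m :: 3
  assumes "k \<noteq> l" "k \<noteq> m" "l \<noteq> m"
  shows "i = k \<or> i = l \<or> i = m"
  using assms exhaust_3[of i] exhaust_3[of k] exhaust_3[of l] exhaust_3[of m] by metis

text \<open>Off the incircle one modulus exceeds the sum of the other two, and
  \<open>\<rho> $ k < 1 / 2\<close> selects which. The indices are an arbitrary permutation, so one
  proof serves all three spikes.\<close>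

lemma spike_region_iff:
  fixes k l m :: 3
  assumes "k \<noteq> l" "k \<noteq> m" "l \<noteq> m"
  shows "\<rho> \<in> spike_region k \<longleftrightarrow>
    0 < 1 - \<rho> $ k \<and> 0 < 1 - \<rho> $ l \<and> 0 < 1 - \<rho> $ m \<and> \<rho> $ k + \<rho> $ l + \<rho> $ m = 2 \<and>
    sqrt (1 - \<rho> $ l) + sqrt (1 - \<rho> $ m) < sqrt (1 - \<rho> $ k)"
    (is "_ \<longleftrightarrow> ?R")
proof -
  have univ: "(\<forall>i. Q i) \<longleftrightarrow> Q k \<and> Q l \<and> Q m" for Q
    using third_index[OF assms] by metis
  have "\<rho> $ 1 + \<rho> $ 2 + \<rho> $ 3 = (\<Sum>i\<in>UNIV. \<rho> $ i)"
    by (simp add: sum_3)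
  also have "UNIV = {k, l, m}"
    using third_index[OF assms] by auto
  also have "(\<Sum>i\<in>{k, l, m}. \<rho> $ i) = \<rho> $ k + \<rho> $ l + \<rho> $ m"
    using assms by simp
  finally have sum: "\<rho> $ 1 + \<rho> $ 2 + \<rho> $ 3 = \<rho> $ k + \<rho> $ l + \<rho> $ m" .
  have defect: "defect (sqrt (1 - \<rho> $ 3)) (sqrt (1 - \<rho> $ 2)) (sqrt (1 - \<rho> $ 1)) \<noteq> 0 \<longleftrightarrow>
    sqrt (1 - \<rho> $ l) + sqrt (1 - \<rho> $ m) < sqrt (1 - \<rho> $ k) \<or>
    sqrt (1 - \<rho> $ k) + sqrt (1 - \<rho> $ m) < sqrt (1 - \<rho> $ l) \<or>
    sqrt (1 - \<rho> $ k) + sqrt (1 - \<rho> $ l) < sqrt (1 - \<rho> $ m)"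
    using exhaust_3[of k] exhaust_3[of l] exhaust_3[of m] assms
    unfolding defect_eq_0_iff by (elim disjE) (simp_all, argo+)
  have plus: "\<rho> \<in> P32_plus \<longleftrightarrow>
    0 < 1 - \<rho> $ k \<and> 0 < 1 - \<rho> $ l \<and> 0 < 1 - \<rho> $ m \<and> \<rho> $ k + \<rho> $ l + \<rho> $ m = 2"
    unfolding P32_plus_def P32_def univ mem_Collect_eq sum by auto
  show ?thesis
  proof
    assume "\<rho> \<in> spike_region k"
    then have \<rho>: "\<rho> \<in> P32_plus" "\<rho> \<notin> incircle" "\<rho> $ k < 1 / 2"
      by (auto simp: spike_region_def)
    have "\<rho> \<in> P32" using \<rho>(1) by (simp add: P32_plus_def)
    then have "defect (sqrt (1 - \<rho> $ 3)) (sqrt (1 - \<rho> $ 2)) (sqrt (1 - \<rho> $ 1)) \<noteq> 0"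
      using \<rho>(2) incircle_iff by blast
    moreover have "\<not> sqrt (1 - \<rho> $ k) + sqrt (1 - \<rho> $ m) < sqrt (1 - \<rho> $ l)"
      using sqrt_add_less_imp[of "1 - \<rho> $ k" "1 - \<rho> $ m" "1 - \<rho> $ l"] \<rho>(1,3) plus by linarith
    moreover have "\<not> sqrt (1 - \<rho> $ k) + sqrt (1 - \<rho> $ l) < sqrt (1 - \<rho> $ m)"
      using sqrt_add_less_imp[of "1 - \<rho> $ k" "1 - \<rho> $ l" "1 - \<rho> $ m"] \<rho>(1,3) plus by linarith
    ultimately show ?R
      using defect plus \<rho>(1) by blast
  next
    assume R: ?R
    then have "\<rho> \<in> P32_plus" using plus by blast
    moreover from this have "\<rho> \<in> P32" by (simp add: P32_plus_def)
    then have "\<rho> \<notin> incircle" using R defect incircle_iff by blast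
    moreover have "\<rho> $ k < 1 / 2"
      using R sqrt_add_less_imp[of "1 - \<rho> $ l" "1 - \<rho> $ m" "1 - \<rho> $ k"] by linarith
    ultimately show "\<rho> \<in> spike_region k"
      by (simp add: spike_region_def)
  qed
qed

lemma Union_spike_region: "P32_plus - incircle = (\<Union>k. spike_region k)"
proof -
  have "\<rho> \<in> (\<Union>k. spike_region k)" if "\<rho> \<in> P32_plus - incircle" for \<rho>
  proof -
    have \<rho>: "\<rho> \<in> P32" "\<forall>i. 0 < 1 - \<rho> $ i" "\<rho> $ 1 + \<rho> $ 2 + \<rho> $ 3 = 2"
      using that by (auto simp: P32_plus_def P32_def)
    then have "defect (sqrt (1 - \<rho> $ 3)) (sqrt (1 - \<rho> $ 2)) (sqrt (1 - \<rho> $ 1)) \<noteq> 0"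
      using that incircle_iff by blast
    then consider "sqrt (1 - \<rho> $ 2) + sqrt (1 - \<rho> $ 1) < sqrt (1 - \<rho> $ 3)"
      | "sqrt (1 - \<rho> $ 3) + sqrt (1 - \<rho> $ 1) < sqrt (1 - \<rho> $ 2)"
      | "sqrt (1 - \<rho> $ 3) + sqrt (1 - \<rho> $ 2) < sqrt (1 - \<rho> $ 1)"
      unfolding defect_eq_0_iff by linarith
    then have "\<rho> \<in> spike_region 3 \<or> \<rho> \<in> spike_region 2 \<or> \<rho> \<in> spike_region 1"
      using \<rho> by cases (simp_all add: spike_region_iff[of 3 2 1] spike_region_iff[of 2 3 1]
          spike_region_iff[of 1 3 2])
    then show ?thesis by blast
  qed
  then show ?thesis by (auto simp: spike_region_def)
qed

text \<open>Two coordinates below 1/2 would push the third above 1.\<close>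

lemma spike_region_half_disjoint:
  assumes "\<rho> \<in> P32" "\<rho> $ i < 1 / 2" "\<rho> $ j < 1 / 2"
  shows "i = j"
  using assms exhaust_3[of i] exhaust_3[of j] by (force simp: P32_def forall_3)

section \<open>Connectedness of the spikes and their corners\<close>

definition corner :: "3 \<Rightarrow> real^3" where
  "corner k = (\<chi> i. if i = k then 0 else 1)"

text \<open>
  In terms of the ratios \<open>s\<close>, \<open>t\<close> of the two smaller moduli to the largest one, a spike is an open
  triangle, which makes its connectedness evident.
\<close>

definition spike_chart :: "3 \<Rightarrow> 3 \<Rightarrow> 3 \<Rightarrow> real \<times> real \<Rightarrow> real^3" where
  "spike_chart k l m = (\<lambda>(s, t). \<chi> i. 1 -
     (of_bool (i = k) + of_bool (i = l) * s\<^sup>2 + of_bool (i = m) * t\<^sup>2) / (1 + s\<^sup>2 + t\<^sup>2))"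

definition chart_domain :: "(real \<times> real) set" where
  "chart_domain = {(s, t). 0 < s \<and> 0 < t \<and> s + t < 1}"

lemma chart_denominator_pos: "0 < 1 + s\<^sup>2 + (t :: real)\<^sup>2"
  by (simp add: add_pos_nonneg)

lemma continuous_on_spike_chart: "continuous_on A (spike_chart k l m)"
  unfolding spike_chart_def case_prod_unfold
  by (intro continuous_on_vec_lambda continuous_intros ballI)
    (metis chart_denominator_pos less_irrefl)

text \<open>The complements \<open>1 - \<rho> $ i\<close> sum to 1, so their ratios determine them;
  dominance of index \<open>k\<close> becomes \<open>s + t < 1\<close>.\<close>

lemma spike_region_eq_image:
  fixes k l m :: 3
  assumes klm: "k \<noteq> l" "k \<noteq> m" "l \<noteq> m"
  shows "spike_region k = spike_chart k l m ` chart_domain"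
proof (intro equalityI subsetI)
  fix \<rho> assume "\<rho> \<in> spike_region k"
  then have \<rho>: "0 < 1 - \<rho> $ k" "0 < 1 - \<rho> $ l" "0 < 1 - \<rho> $ m" "\<rho> $ k + \<rho> $ l + \<rho> $ m = 2"
    "sqrt (1 - \<rho> $ l) + sqrt (1 - \<rho> $ m) < sqrt (1 - \<rho> $ k)"
    using spike_region_iff[OF klm] by auto
  define s t where "s = sqrt (1 - \<rho> $ l) / sqrt (1 - \<rho> $ k)"
    and "t = sqrt (1 - \<rho> $ m) / sqrt (1 - \<rho> $ k)"
  have sq: "s\<^sup>2 = (1 - \<rho> $ l) / (1 - \<rho> $ k)" "t\<^sup>2 = (1 - \<rho> $ m) / (1 - \<rho> $ k)"
    using \<rho> by (simp_all add: s_def t_def power_divide)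
  have n: "1 + s\<^sup>2 + t\<^sup>2 = 1 / (1 - \<rho> $ k)"
  proof -
    have "(1 - \<rho> $ k) + (1 - \<rho> $ l) + (1 - \<rho> $ m) = 1" using \<rho>(4) by simp
    moreover have "1 = (1 - \<rho> $ k) / (1 - \<rho> $ k)" using \<rho>(1) by simp
    ultimately show ?thesis unfolding sq by (metis add_divide_distrib)
  qed
  have "spike_chart k l m (s, t) $ i = \<rho> $ i" for i
    using third_index[OF klm, of i] klm \<rho>(1)
    unfolding spike_chart_def prod.case vec_lambda_beta n by (auto simp: sq)
  then have "\<rho> = spike_chart k l m (s, t)"
    by (simp add: vec_eq_iff)
  moreover have "(s, t) \<in> chart_domain"
    using \<rho> by (simp add: chart_domain_def s_def t_def flip: add_divide_distrib)
  ultimately show "\<rho> \<in> spike_chart k l m ` chart_domain" by blast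
next
  fix \<rho> assume "\<rho> \<in> spike_chart k l m ` chart_domain"
  then obtain s t where st: "0 < s" "0 < t" "s + t < 1" and \<rho>: "\<rho> = spike_chart k l m (s, t)"
    by (auto simp: chart_domain_def)
  define n where "n = 1 + s\<^sup>2 + t\<^sup>2"
  have n: "0 < n" unfolding n_def by (rule chart_denominator_pos)
  have comp: "1 - \<rho> $ k = 1 / n" "1 - \<rho> $ l = s\<^sup>2 / n" "1 - \<rho> $ m = t\<^sup>2 / n"
    using klm by (simp_all add: \<rho> spike_chart_def n_def)
  have "1 / n + s\<^sup>2 / n + t\<^sup>2 / n = 1"
    using n by (simp add: n_def flip: add_divide_distrib)
  then have "\<rho> $ k + \<rho> $ l + \<rho> $ m = 2"
    using comp by linarith
  moreover have "(s + t) / sqrt n < 1 / sqrt n"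
    using st n by (simp add: divide_strict_right_mono)
  ultimately show "\<rho> \<in> spike_region k"
    unfolding spike_region_iff[OF klm] comp using st n
    by (simp add: real_sqrt_divide add_divide_distrib)
qed

lemma connected_chart_domain: "connected chart_domain"
proof (rule convex_connected)
  have "chart_domain = {x. (1, 0) \<bullet> x > 0} \<inter> {x. (0, 1) \<bullet> x > 0} \<inter> {x. (1, 1) \<bullet> x < 1}"
    by (auto simp: chart_domain_def)
  also have "convex \<dots>"
    by (intro convex_Int convex_halfspace_gt convex_halfspace_lt)
  finally show "convex chart_domain" .
qed

lemma other_indices:
  obtains l m :: 3 where "k \<noteq> l" "k \<noteq> m" "l \<noteq> m"
proof -
  have "(1::3) \<noteq> 2" "(1::3) \<noteq> 3" "(2::3) \<noteq> 3" by simp_all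
  then show ?thesis
    using exhaust_3[of k] that by metis
qed

lemma connected_spike_region: "connected (spike_region k)"
proof -
  obtain l m where klm: "k \<noteq> l" "k \<noteq> m" "l \<noteq> m" by (rule other_indices)
  show ?thesis
    unfolding spike_region_eq_image[OF klm]
    using continuous_on_spike_chart connected_chart_domain by (rule connected_continuous_image)
qed

lemma zero_in_closure_chart_domain: "(0, 0) \<in> closure chart_domain"
  unfolding closure_approachable
proof (intro allI impI)
  fix e :: real assume "0 < e"
  \<comment> \<open>The bound \<open>1 / 3\<close> keeps \<open>(\<delta>, \<delta>)\<close> in the
    domain, and \<open>e / 3\<close> keeps its distance from the origin, at most
    \<open>2 * \<delta>\<close>, below \<open>e\<close>.\<close>
  define \<delta> where "\<delta> = min (1/3) (e/3)"
  have "0 < \<delta>" "\<delta> \<le> 1 / 3" "\<delta> \<le> e / 3" using \<open>0 < e\<close> by (auto simp: \<delta>_def)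
  moreover have "sqrt (\<delta>\<^sup>2 + \<delta>\<^sup>2) \<le> \<delta> + \<delta>"
    using \<open>0 < \<delta>\<close> by (intro sqrt_sum_squares_le_sum) auto
  ultimately show "\<exists>y\<in>chart_domain. dist y (0, 0) < e"
    using \<open>0 < e\<close>
    by (intro bexI[of _ "(\<delta>, \<delta>)"]) (auto simp: chart_domain_def dist_Pair_Pair)
qed

lemma corner_in_closure: "corner k \<in> closure (spike_region k)"
proof -
  obtain l m where klm: "k \<noteq> l" "k \<noteq> m" "l \<noteq> m" by (rule other_indices)
  have "spike_chart k l m ` closure chart_domain \<subseteq> closure (spike_region k)"
    unfolding spike_region_eq_image[OF klm]
    by (intro image_closure_subset continuous_on_spike_chart closed_closure closure_subset)
  moreover have "corner k = spike_chart k l m (0, 0)"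
    by (simp add: corner_def spike_chart_def vec_eq_iff)
  ultimately show ?thesis using zero_in_closure_chart_domain by blast
qed

lemma spike_region_nonempty: "spike_region k \<noteq> {}"
  using corner_in_closure[of k] by auto

section \<open>Identification of the connected components\<close>

text \<open>The open sets \<open>W\<close> and \<open>V\<close> cover \<open>C\<close> and do not
  meet inside it, so connectedness keeps \<open>C\<close> on the side of its point
  \<open>x\<close>.\<close>

lemma component_subset_spike_region:
  assumes "C \<in> components (P32_plus - incircle)"
  obtains j where "C \<subseteq> spike_region j"
proof -
  have sub: "C \<subseteq> P32_plus - incircle" and conn: "connected C" and "C \<noteq> {}"
    using assms in_components_subset in_components_connected in_components_nonempty by blast+
  then obtain x j where x: "x \<in> C" "x \<in> spike_region j"
    unfolding Union_spike_region by blast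
  define W where "W = {\<rho> :: real^3. \<rho> $ j < 1 / 2}"
  define V where "V = (\<Union>i\<in>- {j}. {\<rho> :: real^3. \<rho> $ i < 1 / 2})"
  have "open W" "open V"
    unfolding W_def V_def by (auto intro!: open_Collect_less continuous_intros)
  moreover have "W \<inter> V \<inter> C = {}"
  proof -
    have False if "\<rho> \<in> C" "\<rho> $ j < 1 / 2" "\<rho> $ i < 1 / 2" "i \<noteq> j" for \<rho> i
      using that sub spike_region_half_disjoint[of \<rho> i j] by (auto simp: P32_plus_def)
    then show ?thesis by (auto simp: W_def V_def)
  qed
  moreover have "C \<subseteq> W \<union> V"
  proof
    fix \<rho> assume "\<rho> \<in> C"
    then obtain i where "\<rho> \<in> spike_region i"
      using sub Union_spike_region by blast
    then show "\<rho> \<in> W \<union> V"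
      by (cases "i = j") (auto simp: W_def V_def spike_region_def)
  qed
  ultimately have "W \<inter> C = {} \<or> V \<inter> C = {}"
    using connectedD[OF conn] by blast
  moreover have "x \<in> W" using x by (simp add: W_def spike_region_def)
  ultimately have "C \<subseteq> W" using x \<open>C \<subseteq> W \<union> V\<close> by blast
  then have "C \<subseteq> spike_region j"
    using sub by (auto simp: W_def spike_region_def)
  then show ?thesis using that by blast
qed

text \<open>By connectedness the region lies in a component, which in turn lies in some
  \<open>spike_region j\<close>; a common point forces \<open>j = k\<close> and hence
  equality.\<close>

lemma spike_region_in_components: "spike_region k \<in> components (P32_plus - incircle)"
proof -
  have "spike_region k \<subseteq> P32_plus - incircle"
    unfolding Union_spike_region by blast
  moreover from this have "P32_plus - incircle \<noteq> {}"
    using spike_region_nonempty[of k] by auto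
  ultimately obtain C where C: "C \<in> components (P32_plus - incircle)" "spike_region k \<subseteq> C"
    using exists_component_superset connected_spike_region by metis
  obtain j where j: "C \<subseteq> spike_region j"
    using component_subset_spike_region[OF C(1)] .
  obtain x where "x \<in> spike_region k" using spike_region_nonempty by blast
  moreover from this have "x \<in> spike_region j" using C(2) j by blast
  ultimately have "k = j"
    using spike_region_half_disjoint[of x k j] by (simp add: spike_region_def P32_plus_def)
  then have "C = spike_region k" using C(2) j by blast
  then show ?thesis using C(1) by simp
qed

lemma spike_corner: "spike (corner k) = spike_region k"
  unfolding spike_def
proof (rule the_equality)
  show "spike_region k \<in> components (P32_plus - incircle) \<and> corner k \<in> closure (spike_region k)"
    using spike_region_in_components corner_in_closure by blast
next
  fix S assume S: "S \<in> components (P32_plus - incircle) \<and> corner k \<in> closure S"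
  then obtain j where j: "S \<subseteq> spike_region j"
    using component_subset_spike_region by blast
  \<comment> \<open>This half-space is closed, so it contains the corner too, and only the
    \<open>k\<close>-th coordinate of \<open>corner k\<close> is at most 1/2.\<close>
  then have "S \<subseteq> {\<rho>. \<rho> $ j \<le> 1 / 2}"
    by (auto simp: spike_region_def)
  moreover have "closed {\<rho> :: real^3. \<rho> $ j \<le> 1 / 2}"
    by (intro closed_Collect_le continuous_intros)
  ultimately have "corner k \<in> {\<rho>. \<rho> $ j \<le> 1 / 2}"
    using S closure_minimal by blast
  then have "j = k" by (auto simp: corner_def split: if_splits)
  then have "S \<inter> spike_region k \<noteq> {}"
    using S j in_components_nonempty[of S] by auto
  then show "S = spike_region k"
    using S spike_region_in_components[of k] components_eq by blast
qed

text \<open>The index of a region is the site that is empty at its corner, so the numbering differs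
  from that of \<open>S1\<close> and \<open>S2\<close>.\<close>

lemma spikes_eq: "S1 = spike_region 2" "S2 = spike_region 1" "S3 = spike_region 3"
proof -
  have "vector [1, 0, 1] = corner 2" "vector [0, 1, 1] = corner 1" "vector [1, 1, 0] = corner 3"
    by (simp_all add: corner_def vec_eq_iff forall_3 vector_3)
  then show "S1 = spike_region 2" "S2 = spike_region 1" "S3 = spike_region 3"
    by (simp_all add: S1_def S2_def S3_def spike_corner)
qed

text \<open>The constant 4 is \<open>3 + 1\<close>: expanding the squared defect produces the
  squared moduli, which sum to 1.\<close>

lemma F_value_spike_region:
  fixes k l m :: 3
  assumes klm: "k \<noteq> l" "k \<noteq> m" "l \<noteq> m" and \<rho>: "\<rho> \<in> spike_region k"
  shows "F_value \<rho> = 4 + 2 * (sqrt ((1 - \<rho> $ l) * (1 - \<rho> $ m))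
    - sqrt ((1 - \<rho> $ k) * (1 - \<rho> $ l)) - sqrt ((1 - \<rho> $ k) * (1 - \<rho> $ m)))"
proof -
  note * = \<rho>[unfolded spike_region_iff[OF klm]]
  have nonneg: "0 \<le> sqrt (1 - \<rho> $ k)" "0 \<le> sqrt (1 - \<rho> $ l)" "0 \<le> sqrt (1 - \<rho> $ m)"
    using * by auto
  have defect: "defect (sqrt (1 - \<rho> $ 3)) (sqrt (1 - \<rho> $ 2)) (sqrt (1 - \<rho> $ 1)) =
      sqrt (1 - \<rho> $ k) - sqrt (1 - \<rho> $ l) - sqrt (1 - \<rho> $ m)"
    using exhaust_3[of k] exhaust_3[of l] exhaust_3[of m] klm * nonneg
    by (elim disjE) (simp_all add: defect_eq_diff)
  have sum: "(sqrt (1 - \<rho> $ k))\<^sup>2 + (sqrt (1 - \<rho> $ l))\<^sup>2 + (sqrt (1 - \<rho> $ m))\<^sup>2 = 1"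
    using * by simp
  have square: "(x - y - z)\<^sup>2 = (x\<^sup>2 + y\<^sup>2 + z\<^sup>2) + 2 * (y * z - x * y - x * z)" for x y z :: real
    by (simp add: power2_eq_square algebra_simps)
  show ?thesis
    unfolding F_value_def defect real_sqrt_mult square sum by simp
qed


section \<open>Pure-state v-representability\<close>

lemma eigen_equation_iff:
  "(H0 + potential v) *v \<Psi> = complex_of_real 3 *s \<Psi> \<longleftrightarrow>
     \<Psi> $ 1 - \<Psi> $ 2 + \<Psi> $ 3 + of_real (v $ 1 + v $ 2) * \<Psi> $ 1 = 0 \<and>
     - (\<Psi> $ 1 - \<Psi> $ 2 + \<Psi> $ 3) + of_real (v $ 1 + v $ 3) * \<Psi> $ 2 = 0 \<and>
     \<Psi> $ 1 - \<Psi> $ 2 + \<Psi> $ 3 + of_real (v $ 2 + v $ 3) * \<Psi> $ 3 = 0"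
proof -
  have "((H0 + potential v) *v \<Psi>) $ 1 - 3 * \<Psi> $ 1 =
      \<Psi> $ 1 - \<Psi> $ 2 + \<Psi> $ 3 + of_real (v $ 1 + v $ 2) * \<Psi> $ 1"
    "((H0 + potential v) *v \<Psi>) $ 2 - 3 * \<Psi> $ 2 =
      - (\<Psi> $ 1 - \<Psi> $ 2 + \<Psi> $ 3) + of_real (v $ 1 + v $ 3) * \<Psi> $ 2"
    "((H0 + potential v) *v \<Psi>) $ 3 - 3 * \<Psi> $ 3 =
      \<Psi> $ 1 - \<Psi> $ 2 + \<Psi> $ 3 + of_real (v $ 2 + v $ 3) * \<Psi> $ 3"
    by (simp_all add: matrix_vector_mult_def sum_3 H0_def vector_3 potential_def occ_def
        algebra_simps)
  note components = this
  show ?thesis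
    unfolding vec_eq_iff forall_3 vector_smult_component of_real_numeral components[symmetric]
    by simp
qed

lemma ground_stateI:
  fixes \<Psi> :: "complex^3"
  assumes "\<Psi> \<noteq> 0" and eigen: "H *v \<Psi> = complex_of_real E *s \<Psi>"
    and bound: "\<And>\<Phi>. E * (norm \<Phi>)\<^sup>2 \<le> Re (cdot \<Phi> (H *v \<Phi>))"
  shows "ground_state H \<Psi>"
proof -
  have "E \<le> E'" if "\<Phi> \<noteq> 0" "H *v \<Phi> = complex_of_real E' *s \<Phi>" for E' \<Phi>
  proof -
    have "cdot \<Phi> \<Phi> = complex_of_real ((norm \<Phi>)\<^sup>2)"
      unfolding norm_vec3_power2
      by (simp add: cdot_def sum_3 mult.commute flip: complex_norm_square)
    then have "E * (norm \<Phi>)\<^sup>2 \<le> E' * (norm \<Phi>)\<^sup>2"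
      using bound[of \<Phi>] unfolding that(2) cdot_scaleC_right by (simp flip: of_real_mult)
    then show ?thesis using that(1) by simp
  qed
  then show ?thesis
    using assms(1) eigen unfolding ground_state_def eigval_def by blast
qed

lemma pure_v_representableI:
  assumes "norm \<Psi> = 1" "density \<Psi> = \<rho>"
    and "(H0 + potential v) *v \<Psi> = complex_of_real 3 *s \<Psi>"
    and "\<And>a b c :: complex. 0 \<le> (cmod (a + b + c))\<^sup>2 + (v $ 1 + v $ 2) * (cmod a)\<^sup>2
      + (v $ 1 + v $ 3) * (cmod b)\<^sup>2 + (v $ 2 + v $ 3) * (cmod c)\<^sup>2"
  shows "pure_v_representable \<rho>"
proof -
  have "3 * (norm \<Phi>)\<^sup>2 \<le> Re (cdot \<Phi> ((H0 + potential v) *v \<Phi>))" for \<Phi>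
    unfolding energy_eq using assms(4)[of "\<Phi> $ 1" "- \<Phi> $ 2" "\<Phi> $ 3"] by simp
  moreover have "\<Psi> \<noteq> 0" using assms(1) by auto
  ultimately have "ground_state (H0 + potential v) \<Psi>"
    using assms(3) ground_stateI by blast
  then show ?thesis
    using assms(1,2) unfolding pure_v_representable_def by blast
qed

text \<open>The zero potential works: energy 3 means that the rank-one part of \<open>H0\<close>
  annihilates the state, which is then an eigenvector for the lowest eigenvalue 3.\<close>

lemma incircle_pure_v_representable:
  assumes "\<rho> \<in> incircle"
  shows "pure_v_representable \<rho>"
proof -
  have "\<rho> \<in> P32" using assms by (simp add: incircle_def)
  then obtain \<Psi> where \<Psi>: "norm \<Psi> = 1" "density \<Psi> = \<rho>" "Re (cdot \<Psi> (H0 *v \<Psi>)) = F_value \<rho>"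
    using F_value_attained by blast
  have "F_value \<rho> = 3"
    using assms incircle_iff[OF \<open>\<rho> \<in> P32\<close>] by (simp add: F_value_def)
  then have "\<Psi> $ 1 - \<Psi> $ 2 + \<Psi> $ 3 = 0"
    using \<Psi>(1,3) by (simp add: energy_H0_eq)
  then have "(H0 + potential 0) *v \<Psi> = complex_of_real 3 *s \<Psi>"
    unfolding eigen_equation_iff by simp
  then show ?thesis
    using pure_v_representableI[OF \<Psi>(1,2), of 0] by simp
qed

section \<open>Potentials for the spikes and positivity of the associated form\<close>

text \<open>The form vanishes at \<open>(x, y, z)\<close>, the signed amplitudes of the intended
  ground state. In coordinates relative to them it depends only on \<open>\<alpha> - \<beta>\<close>
  and \<open>\<alpha> - \<gamma>\<close>, with nonnegative terms because \<open>y\<close> and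
  \<open>z\<close> are negative and \<open>S\<close> is positive.\<close>

lemma spike_form_nonneg_real:
  fixes x y z a b c :: real
  assumes S: "S = x + y + z" and "0 < x" "y < 0" "z < 0" "0 < S"
  shows "0 \<le> (a + b + c)\<^sup>2 - S / x * a\<^sup>2 - S / y * b\<^sup>2 - S / z * c\<^sup>2"
proof -
  define \<alpha> \<beta> \<gamma> where "\<alpha> = a / x" and "\<beta> = b / y" and "\<gamma> = c / z"
  have abc: "a = x * \<alpha>" "b = y * \<beta>" "c = z * \<gamma>"
    using assms by (simp_all add: \<alpha>_def \<beta>_def \<gamma>_def)
  have div: "S / d * (d * t)\<^sup>2 = S * d * t\<^sup>2" for d t
    by (simp add: power2_eq_square)
  have "(a + b + c)\<^sup>2 - S / x * a\<^sup>2 - S / y * b\<^sup>2 - S / z * c\<^sup>2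
      = (y * (\<alpha> - \<beta>) + z * (\<alpha> - \<gamma>))\<^sup>2 + S * (- y * (\<alpha> - \<beta>)\<^sup>2 + - z * (\<alpha> - \<gamma>)\<^sup>2)"
    unfolding abc div unfolding S by algebra
  moreover have "0 \<le> - y * (\<alpha> - \<beta>)\<^sup>2" "0 \<le> - z * (\<alpha> - \<gamma>)\<^sup>2"
    using assms by (intro mult_nonneg_nonneg; simp)+
  ultimately show ?thesis using \<open>0 < S\<close> by simp
qed

text \<open>The coefficients are real, so the form is the sum of its values at the real and
  imaginary parts.\<close>

lemma spike_form_nonneg:
  fixes a b c :: complex and x y z :: real
  assumes "S = x + y + z" "0 < x" "y < 0" "z < 0" "0 < S"
  shows "0 \<le> (cmod (a + b + c))\<^sup>2 - S / x * (cmod a)\<^sup>2 - S / y * (cmod b)\<^sup>2 - S / z * (cmod c)\<^sup>2"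
  using spike_form_nonneg_real[OF assms, of "Re a" "Re b" "Re c"]
    spike_form_nonneg_real[OF assms, of "Im a" "Im b" "Im c"]
  unfolding cmod_power2 distrib_left plus_complex.sel by linarith

text \<open>Leaving the signs open covers all three spikes at once. Each row of the eigenvalue
  equation is solved for a diagonal entry by dividing by an amplitude.\<close>

lemma signed_amplitudes_pure_v_representable:
  fixes x y z :: real
  assumes "\<rho> $ 1 + \<rho> $ 2 + \<rho> $ 3 = 2" "x\<^sup>2 = 1 - \<rho> $ 3" "y\<^sup>2 = 1 - \<rho> $ 2" "z\<^sup>2 = 1 - \<rho> $ 1"
    and S: "S = x + y + z" and nonzero: "x \<noteq> 0" "y \<noteq> 0" "z \<noteq> 0"
    and form: "\<And>a b c :: complex. 0 \<le> (cmod (a + b + c))\<^sup>2 - S / x * (cmod a)\<^sup>2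
      - S / y * (cmod b)\<^sup>2 - S / z * (cmod c)\<^sup>2"
  shows "pure_v_representable \<rho>"
proof -
  \<comment> \<open>The diagonal entries \<open>-S/x\<close>, \<open>-S/y\<close>, \<open>-S/z\<close> of \<open>potential v\<close> are forced by the eigenvalue equation.\<close>
  define v :: "real^3" where "v = vector
    [(- S / x - S / y + S / z) / 2, (- S / x + S / y - S / z) / 2, (S / x - S / y - S / z) / 2]"
  have v: "v $ 1 + v $ 2 = - S / x" "v $ 1 + v $ 3 = - S / y" "v $ 2 + v $ 3 = - S / z"
    by (simp_all add: v_def vector_3 field_simps)
  define \<Psi> :: "complex^3" where "\<Psi> = vector [of_real x, - of_real y, of_real z]"
  have "norm \<Psi> = 1 \<and> density \<Psi> = \<rho>"
    unfolding norm_density_iff[OF assms(1)] by (simp add: \<Psi>_def vector_3 assms)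
  moreover have "(H0 + potential v) *v \<Psi> = complex_of_real 3 *s \<Psi>"
    unfolding eigen_equation_iff v using nonzero by (simp add: \<Psi>_def vector_3 S)
  moreover have "0 \<le> (cmod (a + b + c))\<^sup>2 + (v $ 1 + v $ 2) * (cmod a)\<^sup>2
      + (v $ 1 + v $ 3) * (cmod b)\<^sup>2 + (v $ 2 + v $ 3) * (cmod c)\<^sup>2" for a b c
    unfolding v using form[of a b c] by simp
  ultimately show ?thesis
    using pure_v_representableI by blast
qed

text \<open>The dominating amplitude is taken positive and the other two negative, so that
  \<open>S\<close> is the positive excess. The positivity lemma expects the positive one first,
  hence the permuted arguments.\<close>

lemma spike_pure_v_representable:
  assumes "\<rho> \<in> spike_region k"
  shows "pure_v_representable \<rho>"
proof -
  define p q r where "p = sqrt (1 - \<rho> $ 3)" and "q = sqrt (1 - \<rho> $ 2)" and "r = sqrt (1 - \<rho> $ 1)"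
  have "\<rho> \<in> P32_plus" using assms by (simp add: spike_region_def)
  then have pos: "0 < p" "0 < q" "0 < r" and sum: "\<rho> $ 1 + \<rho> $ 2 + \<rho> $ 3 = 2"
    by (auto simp: P32_plus_def P32_def p_def q_def r_def)
  have sq: "p\<^sup>2 = 1 - \<rho> $ 3" "q\<^sup>2 = 1 - \<rho> $ 2" "r\<^sup>2 = 1 - \<rho> $ 1"
    using pos by (simp_all add: p_def q_def r_def)
  note repr = signed_amplitudes_pure_v_representable[OF sum]
  consider "k = 1" | "k = 2" | "k = 3" using exhaust_3 by blast
  then show ?thesis
  proof cases
    case 1
    define S where "S = r - q - p"
    have "0 < S"
      using 1 assms spike_region_iff[of 1 2 3 \<rho>] by (simp add: S_def p_def q_def r_def)
    show ?thesis
    proof (rule repr[of "- p" "- q" r S])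
      fix a b c :: complex
      have sum: "c + b + a = a + b + c" by simp
      show "0 \<le> (cmod (a + b + c))\<^sup>2 - S / - p * (cmod a)\<^sup>2 - S / - q * (cmod b)\<^sup>2 - S / r * (cmod c)\<^sup>2"
        using spike_form_nonneg[of S r "- q" "- p" c b a, unfolded sum] pos \<open>0 < S\<close> by (simp add: S_def)
    qed (use pos sq in \<open>simp_all add: S_def\<close>)
  next
    case 2
    define S where "S = q - p - r"
    have "0 < S"
      using 2 assms spike_region_iff[of 2 3 1 \<rho>] by (simp add: S_def p_def q_def r_def)
    show ?thesis
    proof (rule repr[of "- p" q "- r" S])
      fix a b c :: complex
      have sum: "b + a + c = a + b + c" by simp
      show "0 \<le> (cmod (a + b + c))\<^sup>2 - S / - p * (cmod a)\<^sup>2 - S / q * (cmod b)\<^sup>2 - S / - r * (cmod c)\<^sup>2"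
        using spike_form_nonneg[of S q "- p" "- r" b a c, unfolded sum] pos \<open>0 < S\<close> by (simp add: S_def)
    qed (use pos sq in \<open>simp_all add: S_def\<close>)
  next
    case 3
    define S where "S = p - q - r"
    have "0 < S"
      using 3 assms spike_region_iff[of 3 2 1 \<rho>] by (simp add: S_def p_def q_def r_def)
    show ?thesis
    proof (rule repr[of p "- q" "- r" S])
      fix a b c :: complex
      show "0 \<le> (cmod (a + b + c))\<^sup>2 - S / p * (cmod a)\<^sup>2 - S / - q * (cmod b)\<^sup>2 - S / - r * (cmod c)\<^sup>2"
        using spike_form_nonneg[of S p "- q" "- r" a b c] pos \<open>0 < S\<close> by (simp add: S_def)
    qed (use pos sq in \<open>simp_all add: S_def\<close>)
  qed
qed

lemma P32_plus_pure_v_representable: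
  assumes "\<rho> \<in> P32_plus"
  shows "pure_v_representable \<rho>"
  using assms Union_spike_region incircle_pure_v_representable spike_pure_v_representable by blast

theorem mainTheorem9:
  shows "(\<forall>\<rho> \<in> P32_plus. pure_v_representable \<rho>) \<and>
    F_pure = F_mixed \<and>
    ereal_convex F_pure \<and>
    (\<forall>\<rho> :: real^3.
      let \<alpha>1 = sqrt ((1 - \<rho> $ 1) * (1 - \<rho> $ 3));
          \<alpha>2 = sqrt ((1 - \<rho> $ 1) * (1 - \<rho> $ 2));
          \<alpha>3 = sqrt ((1 - \<rho> $ 2) * (1 - \<rho> $ 3))
      in (\<rho> \<in> incircle \<longrightarrow> F_pure \<rho> = ereal 3) \<and>
         (\<rho> \<in> S1 \<longrightarrow> F_pure \<rho> = ereal (4 + 2 * (\<alpha>1 - \<alpha>2 - \<alpha>3))) \<and>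
         (\<rho> \<in> S2 \<longrightarrow> F_pure \<rho> = ereal (4 + 2 * (- \<alpha>1 - \<alpha>2 + \<alpha>3))) \<and>
         (\<rho> \<in> S3 \<longrightarrow> F_pure \<rho> = ereal (4 + 2 * (- \<alpha>1 + \<alpha>2 - \<alpha>3))))"
proof (intro conjI ballI allI, goal_cases)
  case (1 \<rho>)
  then show ?case by (rule P32_plus_pure_v_representable)
next
  case 2
  show ?case by (simp add: fun_eq_iff F_pure_eq F_mixed_eq)
next
  case 3
  show ?case by (rule F_pure_convex)
next
  case (4 \<rho>)
  have "F_pure \<rho> = ereal 3" if "\<rho> \<in> incircle"
  proof -
    have "\<rho> \<in> P32" using that by (simp add: incircle_def)
    then show ?thesis using that incircle_iff by (simp add: F_pure_eq F_value_def)
  qed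
  moreover have "F_pure \<rho> = ereal (F_value \<rho>)" if "\<rho> \<in> spike_region k" for k
    using that by (simp add: F_pure_eq spike_region_def P32_plus_def)
  ultimately show ?case
    unfolding Let_def spikes_eq
    using F_value_spike_region[of 2 1 3 \<rho>] F_value_spike_region[of 1 2 3 \<rho>]
      F_value_spike_region[of 3 1 2 \<rho>]
    by (auto simp: algebra_simps)
qed

end
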